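(* For any $r\in(0,1)$ there exists a probability measure $\mu$ on $\mathbb{R}_+=[0,\infty)$ such that, for the quantile admission process with veto power with parameters $\mu,r$ and $\nu_\infty=\lim_{t\to\infty}\nu^*_t$ the almost sure weak limit of its empirical distributions, there are infinitely many distinct probability measures $\nu$ with $\mathbb{P}(\nu_\infty=\nu)>0$.
   Context: Process. Let $(X_t,Y_t)_{t\ge 1}$ be independent pairs of independent $\mu$-distributed random variables. Let $\mathcal{S}_0=\emptyset$, a multiset of reals. For $t\ge1$: if $\#\{s\in\mathcal{S}_{t-1}: s\le \frac{X_t+Y_t}{2}\}\ge r|\mathcal{S}_{t-1}|$ (counted with multiplicity), then $\mathcal{S}_t$ is $\mathcal{S}_{t-1}$ with one additional copy of $\min(X_t,Y_t)$; otherwise $\mathcal{S}_t=\mathcal{S}_{t-1}$. For $t\ge 1$ put $\nu^*_t=\frac{1}{|\mathcal{S}_t|}\sum_{s\in\mathcal{S}_t}\delta_s$. It is known that for every probability measure $\mu$ on $\mathbb{R}_+$ and $r\in(0,1)$, $\nu^*_t$ converges weakly almost surely to a (possibly random) probability measure $\nu_\infty$. *)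

theory Defs
  imports "HOL-Probability.Probability"
begin

primrec veto_admitted :: "real \<Rightarrow> (nat \<Rightarrow> real) \<Rightarrow> (nat \<Rightarrow> real) \<Rightarrow> nat \<Rightarrow> real multiset" where
  "veto_admitted r x y 0 = {#}"
| "veto_admitted r x y (Suc t) =
     (let S = veto_admitted r x y t in
      if real (size {#s \<in># S. s \<le> (x (Suc t) + y (Suc t)) / 2#}) \<ge> r * real (size S)
      then add_mset (min (x (Suc t)) (y (Suc t))) S
      else S)"

(* The first step always admits (0 \<ge> r * 0), so the multiset is nonempty for t \<ge> 1; the value
   at t = 0 is junk. The push-forward under the identity only turns the discrete sigma-algebra
   of the pmf into the Borel one. *)
definition veto_empirical :: "real \<Rightarrow> (nat \<Rightarrow> real) \<Rightarrow> (nat \<Rightarrow> real) \<Rightarrow> nat \<Rightarrow> real measure" where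
  "veto_empirical r x y t =
     distr (measure_pmf (pmf_of_multiset (veto_admitted r x y t))) borel (\<lambda>s. s)"

(* The weak limit along one realisation (x, y) of the input. Without a limit the value is the
   null measure, which is not a probability measure, so exceptional realisations contribute
   nothing to the event that the limit equals a given probability measure. *)
definition veto_limit :: "real \<Rightarrow> (nat \<Rightarrow> real) \<Rightarrow> (nat \<Rightarrow> real) \<Rightarrow> real measure" where
  "veto_limit r x y =
     (if \<exists>\<nu>. real_distribution \<nu> \<and> weak_conv_m (veto_empirical r x y) \<nu>
      then THE \<nu>. real_distribution \<nu> \<and> weak_conv_m (veto_empirical r x y) \<nu>
      else null_measure borel)"

definition veto_inputs ::
  "'w measure \<Rightarrow> real measure \<Rightarrow> (nat \<Rightarrow> 'w \<Rightarrow> real) \<Rightarrow> (nat \<Rightarrow> 'w \<Rightarrow> real) \<Rightarrow> bool" where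
  "veto_inputs M \<mu> X Y \<longleftrightarrow>
     prob_space M \<and>
     prob_space.indep_vars M (\<lambda>_. borel \<Otimes>\<^sub>M borel) (\<lambda>t \<omega>. (X t \<omega>, Y t \<omega>)) {1..} \<and>
     (\<forall>t\<ge>1. prob_space.indep_var M borel (X t) borel (Y t) \<and>
        distr M borel (X t) = \<mu> \<and> distr M borel (Y t) = \<mu>)"

definition veto_limit_atoms ::
  "real \<Rightarrow> 'w measure \<Rightarrow> (nat \<Rightarrow> 'w \<Rightarrow> real) \<Rightarrow> (nat \<Rightarrow> 'w \<Rightarrow> real) \<Rightarrow> real measure set" where
  "veto_limit_atoms r M X Y =
     {\<nu>. real_distribution \<nu> \<and> \<P>(\<omega> in M. veto_limit r (\<lambda>t. X t \<omega>) (\<lambda>t. Y t \<omega>) = \<nu>) > 0}"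

(* The canonical model of the input, on which X t and Y t are the two components of the
   coordinate t. It exists on a fixed sample space for every \<mu>, see veto_inputs_canonical. *)
definition veto_space :: "real measure \<Rightarrow> (nat \<Rightarrow> real \<times> real) measure" where
  "veto_space \<mu> = (\<Pi>\<^sub>M t\<in>{1..}. \<mu> \<Otimes>\<^sub>M \<mu>)"

lemma veto_admitted_nonempty: "t \<ge> 1 \<Longrightarrow> veto_admitted r x y t \<noteq> {#}"
proof (induction t)
  case (Suc t)
  then show ?case by (cases t) (auto simp: Let_def)
qed simp

lemma measure_veto_empirical:
  assumes "t \<ge> 1" "A \<in> sets borel"
  shows "measure (veto_empirical r x y t) A =
    real (size {#s \<in># veto_admitted r x y t. s \<in> A#}) / real (size (veto_admitted r x y t))"
proof -
  define S where "S = veto_admitted r x y t"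
  have ne: "S \<noteq> {#}" using veto_admitted_nonempty[OF assms(1)] by (simp add: S_def)
  have "measure (veto_empirical r x y t) A = measure (measure_pmf (pmf_of_multiset S)) A"
    using assms(2) by (simp add: veto_empirical_def S_def measure_distr)
  also have "\<dots> = measure (measure_pmf (pmf_of_multiset S)) (A \<inter> set_mset S)"
    using measure_Int_set_pmf[of "pmf_of_multiset S" A] ne by simp
  also have "\<dots> = (\<Sum>s\<in>A \<inter> set_mset S. real (count S s) / real (size S))"
    using ne by (subst measure_measure_pmf_finite) auto
  also have "\<dots> = real (\<Sum>s\<in>A \<inter> set_mset S. count S s) / real (size S)"
    by (simp add: sum_divide_distrib)
  also have "(\<Sum>s\<in>A \<inter> set_mset S. count S s) = size {#s \<in># S. s \<in> A#}"
    by (auto simp: size_multiset_overloaded_eq intro!: sum.cong)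
  finally show ?thesis by (simp add: S_def)
qed

lemma veto_limit_eqI:
  assumes "real_distribution \<nu>" "weak_conv_m (veto_empirical r x y) \<nu>"
  shows "veto_limit r x y = \<nu>"
proof -
  have "\<nu>' = \<nu>" if *: "real_distribution \<nu>'" "weak_conv_m (veto_empirical r x y) \<nu>'" for \<nu>'
  proof (rule cdf_unique)
    interpret A: real_distribution \<nu> by fact
    interpret B: real_distribution \<nu>' by fact
    show "real_distribution \<nu>" "real_distribution \<nu>'" by fact+
    define D where "D = {x. \<not> isCont (cdf \<nu>) x} \<union> {x. \<not> isCont (cdf \<nu>') x}"
    have D: "countable D"
      unfolding D_def using A.countable_atoms B.countable_atoms
      by (simp add: A.isCont_cdf B.isCont_cdf zero_less_measure_iff)
    have eq: "cdf \<nu>' z = cdf \<nu> z" if "z \<notin> D" for z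
      using that assms(2) *(2) unfolding D_def weak_conv_m_def weak_conv_def
      by (auto intro: LIMSEQ_unique)
    show "cdf \<nu>' = cdf \<nu>"
    proof
      fix a
      have "\<exists>z. z \<notin> D \<and> a < z \<and> z < a + 1 / real (Suc n)" for n
      proof -
        have "uncountable ({a<..<a + 1 / real (Suc n)} - D)"
          using D uncountable_open_interval[of a "a + 1 / real (Suc n)"]
          by (simp add: uncountable_minus_countable)
        then have "{a<..<a + 1 / real (Suc n)} - D \<noteq> {}" by (metis countable_empty)
        then show ?thesis by auto
      qed
      then obtain z where z: "\<And>n. z n \<notin> D" "\<And>n. a < z n" "\<And>n. z n < a + 1 / real (Suc n)"
        by metis
      have "z \<longlonglongrightarrow> a"
      proof (rule tendsto_sandwich)
        show "\<forall>\<^sub>F n in sequentially. a \<le> z n"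
          by (intro always_eventually allI less_imp_le z(2))
        show "\<forall>\<^sub>F n in sequentially. z n \<le> a + 1 / real (Suc n)"
          by (intro always_eventually allI less_imp_le z(3))
        show "(\<lambda>n. a + 1 / real (Suc n)) \<longlonglongrightarrow> a"
          using tendsto_add[OF tendsto_const[of a] LIMSEQ_inverse_real_of_nat]
          by (simp add: inverse_eq_divide)
      qed simp
      then have zr: "filterlim z (at_right a) sequentially"
        unfolding filterlim_at by (simp add: z(2) less_imp_neq[OF z(2), THEN not_sym])
      have "(\<lambda>n. cdf \<nu> (z n)) \<longlonglongrightarrow> cdf \<nu> a"
        using A.cdf_is_right_cont[of a] zr
        unfolding continuous_within by (rule filterlim_compose)
      moreover have "(\<lambda>n. cdf \<nu>' (z n)) \<longlonglongrightarrow> cdf \<nu>' a"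
        using B.cdf_is_right_cont[of a] zr
        unfolding continuous_within by (rule filterlim_compose)
      ultimately show "cdf \<nu>' a = cdf \<nu> a"
        using eq[OF z(1)] by (simp add: LIMSEQ_unique)
    qed
  qed
  then have "(THE \<nu>. real_distribution \<nu> \<and> weak_conv_m (veto_empirical r x y) \<nu>) = \<nu>"
    using assms by (intro the_equality) blast+
  moreover have "\<exists>\<nu>. real_distribution \<nu> \<and> weak_conv_m (veto_empirical r x y) \<nu>"
    using assms by blast
  ultimately show ?thesis
    unfolding veto_limit_def by presburger
qed

lemma veto_inputs_canonical:
  assumes "real_distribution \<mu>"
  shows "veto_inputs (veto_space \<mu>) \<mu> (\<lambda>t \<omega>. fst (\<omega> t)) (\<lambda>t \<omega>. snd (\<omega> t))"
proof -
  interpret real_distribution \<mu> by fact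
  interpret P: pair_prob_space \<mu> \<mu> ..
  have ps: "prob_space (veto_space \<mu>)"
    unfolding veto_space_def by (intro prob_space_PiM P.prob_space_axioms)
  interpret V: prob_space "veto_space \<mu>" by (rule ps)
  have sets: "sets (\<mu> \<Otimes>\<^sub>M \<mu>) = sets (borel \<Otimes>\<^sub>M borel)"
    by (intro sets_pair_measure_cong) simp_all
  have co: "distr (veto_space \<mu>) (\<mu> \<Otimes>\<^sub>M \<mu>) (\<lambda>\<omega>. \<omega> t) = \<mu> \<Otimes>\<^sub>M \<mu>" if "t \<ge> 1" for t
    unfolding veto_space_def using that
    by (intro distr_PiM_component P.prob_space_axioms) auto
  have mt: "(\<lambda>\<omega>. \<omega> t) \<in> veto_space \<mu> \<rightarrow>\<^sub>M \<mu> \<Otimes>\<^sub>M \<mu>" if "t \<ge> 1" for t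
    unfolding veto_space_def by (rule measurable_component_singleton) (use that in simp)
  have mf: "fst \<in> \<mu> \<Otimes>\<^sub>M \<mu> \<rightarrow>\<^sub>M borel" "snd \<in> \<mu> \<Otimes>\<^sub>M \<mu> \<rightarrow>\<^sub>M borel"
    by measurable
  have m1: "(\<lambda>\<omega>. fst (\<omega> t)) \<in> borel_measurable (veto_space \<mu>)"
    and m2: "(\<lambda>\<omega>. snd (\<omega> t)) \<in> borel_measurable (veto_space \<mu>)" if "t \<ge> 1" for t
    using measurable_compose[OF mt[OF that] mf(1)] measurable_compose[OF mt[OF that] mf(2)]
    by simp_all
  have pair: "distr (veto_space \<mu>) (borel \<Otimes>\<^sub>M borel) (\<lambda>\<omega>. (fst (\<omega> t), snd (\<omega> t))) = \<mu> \<Otimes>\<^sub>M \<mu>"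
    if "t \<ge> 1" for t
    using co[OF that] distr_cong[OF refl sets, of "veto_space \<mu>" "\<lambda>\<omega>. \<omega> t" "\<lambda>\<omega>. \<omega> t"] by simp
  have d1: "distr (veto_space \<mu>) borel (\<lambda>\<omega>. fst (\<omega> t)) = \<mu>" if "t \<ge> 1" for t
  proof -
    have "distr (veto_space \<mu>) borel (\<lambda>\<omega>. fst (\<omega> t)) =
        distr (distr (veto_space \<mu>) (\<mu> \<Otimes>\<^sub>M \<mu>) (\<lambda>\<omega>. \<omega> t)) borel fst"
      by (subst distr_distr[OF mf(1) mt[OF that]]) (simp add: comp_def)
    also have "\<dots> = distr (\<mu> \<Otimes>\<^sub>M \<mu>) \<mu> fst"
      unfolding co[OF that] by (intro distr_cong) auto
    also have "\<dots> = \<mu>" by (rule distr_pair_fst)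
    finally show ?thesis .
  qed
  have swap: "distr (\<mu> \<Otimes>\<^sub>M \<mu>) \<mu> snd = \<mu>"
  proof -
    have "distr (\<mu> \<Otimes>\<^sub>M \<mu>) \<mu> snd =
        distr (distr (\<mu> \<Otimes>\<^sub>M \<mu>) (\<mu> \<Otimes>\<^sub>M \<mu>) (\<lambda>(x, y). (y, x))) \<mu> snd"
      using P.distr_pair_swap by simp
    also have "\<dots> = distr (\<mu> \<Otimes>\<^sub>M \<mu>) \<mu> fst"
      by (subst distr_distr) (auto simp: comp_def case_prod_beta)
    also have "\<dots> = \<mu>" by (rule distr_pair_fst)
    finally show ?thesis .
  qed
  have d2: "distr (veto_space \<mu>) borel (\<lambda>\<omega>. snd (\<omega> t)) = \<mu>" if "t \<ge> 1" for t
  proof -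
    have "distr (veto_space \<mu>) borel (\<lambda>\<omega>. snd (\<omega> t)) =
        distr (distr (veto_space \<mu>) (\<mu> \<Otimes>\<^sub>M \<mu>) (\<lambda>\<omega>. \<omega> t)) borel snd"
      by (subst distr_distr[OF mf(2) mt[OF that]]) (simp add: comp_def)
    also have "\<dots> = distr (\<mu> \<Otimes>\<^sub>M \<mu>) \<mu> snd"
      unfolding co[OF that] by (intro distr_cong) auto
    also have "\<dots> = \<mu>" by (rule swap)
    finally show ?thesis .
  qed
  have "V.indep_var borel (\<lambda>\<omega>. fst (\<omega> t)) borel (\<lambda>\<omega>. snd (\<omega> t))" if "t \<ge> 1" for t
    unfolding V.indep_var_distribution_eq d1[OF that] d2[OF that] pair[OF that]
    using m1[OF that] m2[OF that] by simp
  moreover have "V.indep_vars (\<lambda>_. borel \<Otimes>\<^sub>M borel) (\<lambda>t \<omega>. (fst (\<omega> t), snd (\<omega> t))) {1..}"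
  proof -
    have rv: "(\<lambda>\<omega>. \<omega> t) \<in> veto_space \<mu> \<rightarrow>\<^sub>M \<mu> \<Otimes>\<^sub>M \<mu>" if "t \<in> {1..}" for t
      using mt that by simp
    have "V.indep_vars (\<lambda>_. \<mu> \<Otimes>\<^sub>M \<mu>) (\<lambda>t \<omega>. \<omega> t) {1..}"
    proof (subst V.indep_vars_iff_distr_eq_PiM')
      have "distr (veto_space \<mu>) (\<Pi>\<^sub>M t\<in>{1..}. \<mu> \<Otimes>\<^sub>M \<mu>) (\<lambda>\<omega>. \<lambda>t\<in>{1..}. \<omega> t) =
          distr (veto_space \<mu>) (veto_space \<mu>) (\<lambda>\<omega>. \<omega>)"
        by (intro distr_cong) (auto simp: veto_space_def space_PiM PiE_def extensional_restrict)
      also have "\<dots> = (\<Pi>\<^sub>M t\<in>{1..}. \<mu> \<Otimes>\<^sub>M \<mu>)"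
        by (simp add: veto_space_def)
      also have "\<dots> = (\<Pi>\<^sub>M t\<in>{1..}. distr (veto_space \<mu>) (\<mu> \<Otimes>\<^sub>M \<mu>) (\<lambda>\<omega>. \<omega> t))"
        by (intro PiM_cong) (auto simp: co)
      finally show "distr (veto_space \<mu>) (\<Pi>\<^sub>M t\<in>{1..}. \<mu> \<Otimes>\<^sub>M \<mu>) (\<lambda>\<omega>. \<lambda>t\<in>{1..}. \<omega> t) =
          (\<Pi>\<^sub>M t\<in>{1..}. distr (veto_space \<mu>) (\<mu> \<Otimes>\<^sub>M \<mu>) (\<lambda>\<omega>. \<omega> t))" .
    qed (auto intro: rv)
    then have "V.indep_vars (\<lambda>_. borel \<Otimes>\<^sub>M borel)
        (\<lambda>t. (\<lambda>z. (fst z, snd z)) \<circ> (\<lambda>\<omega>. \<omega> t)) {1..}"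
      by (rule V.indep_vars_compose) (simp add: measurable_cong_sets[OF sets refl])
    then show ?thesis by (simp add: comp_def)
  qed
  ultimately show ?thesis
    unfolding veto_inputs_def using ps d1 d2 by auto
qed

end

theory Submission
  imports Defs
begin

text \<open>
  A pair is admitted iff its mean is at least the current \<open>r\<close>-quantile of the admitted multiset.
  As long as this quantile sits at a fixed value \<open>q\<close>, the admitted pairs are exactly those
  with mean at least \<open>q\<close>, and the admitted values are independent samples of the law of the
  minimum of a pair conditioned on its mean being at least \<open>q\<close>. If that law charges
  \<open>{..<q}\<close> with less than \<open>r\<close> and \<open>{..q}\<close> with more than \<open>r\<close>, its own
  \<open>r\<close>-quantile is \<open>q\<close>, so the situation is self-reinforcing. If moreover \<open>q\<close> is
  an atom of \<open>\<mu>\<close>, the process can be brought there: with positive probability the first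
  \<open>n\<close> pairs all equal \<open>(q, q)\<close>, and then the multiset consists of \<open>n\<close> copies of
  \<open>q\<close>. Such a \<open>q\<close> is called a trap (\<open>veto_trap\<close>).

  By the law of large numbers the two random walks that measure how far the quantile is from leaving
  \<open>q\<close> have positive drift, hence are almost surely bounded below, and for some \<open>n\<close> the
  initial stock of \<open>n\<close> copies outweighs this bound with positive probability. Independence of
  the first \<open>n\<close> pairs from the later ones shows that the process then stays at \<open>q\<close>
  forever with positive probability, and on this event the empirical laws converge to the
  conditional law (\<open>prob_trap_limit_pos\<close>). Laws of different traps differ because their
  \<open>r\<close>-quantiles differ (\<open>trap_law_neq\<close>).

  It remains to find \<open>\<mu>\<close> with infinitely many traps. A mean of at least \<open>q\<close> with
  minimum below \<open>q\<close> requires one value above \<open>q\<close>, whereas the pair \<open>(q, q)\<close>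
  alone contributes \<open>\<mu>{q}\<^sup>2\<close>. So \<open>q\<close> is a trap as soon as the tail beyond \<open>q\<close> is
  negligible against \<open>\<mu>{q}\<^sup>2\<close> (\<open>veto_trap_if_light_tail\<close>). For a law on the natural
  numbers whose tails are squared, up to a small constant factor, at each step this holds at every number.
\<close>

section \<open>Weak convergence of distribution functions\<close>

text \<open>
  Monotonicity replaces the condition at all continuity points of the limit by countably many
  conditions. In this form the event of converging to a given law is visibly measurable.
\<close>

lemma weak_conv_iff_rational_bounds:
  fixes f :: "nat \<Rightarrow> real \<Rightarrow> real" and F :: "real \<Rightarrow> real"
  assumes f: "\<And>n. mono (f n)" and F: "mono F"
  shows "weak_conv f F \<longleftrightarrow> (\<forall>a b :: rat. a < b \<longrightarrow> (\<forall>k. \<forall>\<^sub>F n in sequentially.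
    f n (real_of_rat a) < F (real_of_rat b) + 1 / real (Suc k) \<and>
    F (real_of_rat a) - 1 / real (Suc k) < f n (real_of_rat b)))"
    (is "_ \<longleftrightarrow> ?R")
proof
  assume conv: "weak_conv f F"
  show ?R
  proof (intro allI impI)
    fix a b :: rat and k :: nat assume "a < b"
    then have ab: "real_of_rat a < real_of_rat b" by (simp add: of_rat_less)
    \<comment> \<open>A monotone function has a continuity point in every interval.\<close>
    have "uncountable ({real_of_rat a<..<real_of_rat b} - {x. \<not> isCont F x})"
      using mono_ctble_discont[OF F] uncountable_open_interval[of "real_of_rat a" "real_of_rat b"] ab
      by (simp add: uncountable_minus_countable)
    then have "{real_of_rat a<..<real_of_rat b} - {x. \<not> isCont F x} \<noteq> {}"
      by (metis countable_empty)
    then obtain c where c: "real_of_rat a < c" "c < real_of_rat b" "isCont F c" by auto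
    have "(\<lambda>n. f n c) \<longlonglongrightarrow> F c" using conv c(3) unfolding weak_conv_def by blast
    moreover have "0 < 1 / real (Suc k)" by simp
    ultimately have "\<forall>\<^sub>F n in sequentially. dist (f n c) (F c) < 1 / real (Suc k)"
      by (rule tendstoD)
    then show "\<forall>\<^sub>F n in sequentially.
        f n (real_of_rat a) < F (real_of_rat b) + 1 / real (Suc k) \<and>
        F (real_of_rat a) - 1 / real (Suc k) < f n (real_of_rat b)"
    proof eventually_elim
      case (elim n)
      have "f n (real_of_rat a) \<le> f n c" "f n c \<le> f n (real_of_rat b)"
        using f[of n] c by (auto intro: monoD)
      moreover have "F (real_of_rat a) \<le> F c" "F c \<le> F (real_of_rat b)"
        using F c by (auto intro: monoD)
      ultimately show ?case
        using elim unfolding dist_real_def by linarith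
    qed
  qed
next
  assume R: ?R
  show "weak_conv f F"
    unfolding weak_conv_def
  proof (intro allI impI tendstoI)
    fix x e :: real assume cont: "isCont F x" and e: "0 < e"
    obtain d where d: "d > 0" "\<And>y. \<bar>y - x\<bar> < d \<Longrightarrow> \<bar>F y - F x\<bar> < e / 2"
      using cont e unfolding continuous_at_eps_delta dist_real_def
      by (metis half_gt_zero)
    obtain k where k: "1 / real (Suc k) < e / 2"
      using e by (metis half_gt_zero nat_approx_posE)
    obtain a where a: "x - d < real_of_rat a" "real_of_rat a < x"
      using of_rat_dense[of "x - d" x] d(1) by auto
    obtain a' where a': "real_of_rat a < real_of_rat a'" "real_of_rat a' < x"
      using of_rat_dense[of "real_of_rat a" x] a by auto
    obtain b where b: "x < real_of_rat b" "real_of_rat b < x + d"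
      using of_rat_dense[of x "x + d"] d(1) by auto
    obtain b' where b': "x < real_of_rat b'" "real_of_rat b' < real_of_rat b"
      using of_rat_dense[of x "real_of_rat b"] b by auto
    have "a < a'" "b' < b" using a'(1) b'(2) by (simp_all add: of_rat_less)
    note bounds = R[rule_format, OF this(1), of k] R[rule_format, OF this(2), of k]
    have "\<forall>\<^sub>F n in sequentially. F (real_of_rat a) - 1 / real (Suc k) < f n (real_of_rat a')"
      using bounds(1) by (rule eventually_mono) blast
    moreover have "\<forall>\<^sub>F n in sequentially. f n (real_of_rat b') < F (real_of_rat b) + 1 / real (Suc k)"
      using bounds(2) by (rule eventually_mono) blast
    ultimately show "\<forall>\<^sub>F n in sequentially. dist (f n x) (F x) < e"
    proof eventually_elim
      case (elim n)
      have "f n (real_of_rat a') \<le> f n x" "f n x \<le> f n (real_of_rat b')"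
        using f[of n] a' b' by (auto intro: monoD)
      moreover have "\<bar>F (real_of_rat a) - F x\<bar> < e / 2"
        by (rule d(2)) (use a in linarith)
      moreover have "\<bar>F (real_of_rat b) - F x\<bar> < e / 2"
        by (rule d(2)) (use b in linarith)
      ultimately show ?case
        using elim k unfolding dist_real_def by linarith
    qed
  qed
qed

lemma weak_conv_if_tendsto_rational:
  fixes f :: "nat \<Rightarrow> real \<Rightarrow> real" and F :: "real \<Rightarrow> real"
  assumes f: "\<And>n. mono (f n)" and F: "mono F"
    and conv: "\<And>a :: rat. (\<lambda>n. f n (real_of_rat a)) \<longlonglongrightarrow> F (real_of_rat a)"
  shows "weak_conv f F"
  unfolding weak_conv_iff_rational_bounds[OF f F]
proof (intro allI impI)
  fix a b :: rat and k :: nat assume "a < b"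
  then have "F (real_of_rat a) \<le> F (real_of_rat b)"
    using F by (simp add: monoD of_rat_less_eq)
  moreover have "0 < 1 / real (Suc k)" by simp
  ultimately show "\<forall>\<^sub>F n in sequentially.
      f n (real_of_rat a) < F (real_of_rat b) + 1 / real (Suc k) \<and>
      F (real_of_rat a) - 1 / real (Suc k) < f n (real_of_rat b)"
    by (intro eventually_conj order_tendstoD[OF conv]) linarith+
qed

section \<open>Relative frequencies in independent trials\<close>

text \<open>
  The strong law of large numbers for indicators: Hoeffding's inequality makes the deviation
  probabilities summable, and the Borel-Cantelli lemma applies.
\<close>

lemma (in sequence_space) AE_frequency_tendsto:
  assumes A [measurable]: "A \<in> sets M"
  shows "AE z in S. (\<lambda>n. (\<Sum>i<n. indicator A (z i)) / real n) \<longlonglongrightarrow> measure M A"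
proof -
  let ?X = "\<lambda>i z. indicator A (z i) :: real"
  have comp: "distr S M (\<lambda>z. z i) = M" for i
    by (intro distr_PiM_component) (auto intro: M.prob_space_axioms)
  have "P.indep_vars (\<lambda>_. M) (\<lambda>i z. z i) UNIV"
    by (subst P.indep_vars_iff_distr_eq_PiM) (auto simp: comp restrict_UNIV)
  then have indep: "P.indep_vars (\<lambda>_. borel) ?X UNIV"
    by (rule P.indep_vars_compose2) simp
  have distr: "distr S borel (?X i) = distr M borel (indicator A)" for i
    by (subst (2) comp[of i, symmetric], subst distr_distr) (auto simp: comp_def)
  have E: "P.expectation (?X 0) = measure M A"
  proof -
    have "P.expectation (?X 0) = (\<integral>x. indicator A x \<partial>distr S M (\<lambda>z. z 0))"
      by (subst integral_distr) auto
    then show ?thesis by (simp add: comp Int_absorb2[OF sets.sets_into_space[OF A]])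
  qed
  have bound: "P.prob {z \<in> space S. \<bar>(\<Sum>i<n. ?X i z) / real n - measure M A\<bar> \<ge> e}
      \<le> 2 * exp (- 2 * e\<^sup>2) ^ n" if "e > 0" "n > 0" for e n
  proof -
    interpret H: Hoeffding_ineq_iid S "{..<n}" ?X "?X 0" 0 1 "measure M A"
    proof unfold_locales
      show "P.indep_vars (\<lambda>_. borel) ?X {..<n}"
        by (rule P.indep_vars_subset[OF indep]) auto
      show "measure M A \<equiv> P.expectation (?X 0)" using E by simp
    qed (auto simp: distr)
    show ?thesis
      using H.Hoeffding_ineq_abs_ge'[of e] that
      by (auto simp: exp_of_nat_mult[symmetric] mult_ac lessThan_empty_iff)
  qed
  have "AE z in S. \<forall>\<^sub>F n in sequentially. \<bar>(\<Sum>i<n. ?X i z) / real n - measure M A\<bar> < 1 / real (Suc k)"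
    for k
  proof -
    let ?e = "1 / real (Suc k)"
    let ?B = "\<lambda>n. {z \<in> space S. \<bar>(\<Sum>i<n. ?X i z) / real n - measure M A\<bar> \<ge> ?e}"
    have "summable (\<lambda>n. P.prob (?B n))"
    proof (rule summable_comparison_test'[where N = 1])
      show "summable (\<lambda>n. 2 * exp (- 2 * ?e\<^sup>2) ^ n)"
        by (intro summable_mult summable_geometric) simp
      show "norm (P.prob (?B n)) \<le> 2 * exp (- 2 * ?e\<^sup>2) ^ n" if "n \<ge> 1" for n
        using bound[of ?e n] that by simp
    qed
    then have "AE z in S. \<forall>\<^sub>F n in sequentially. z \<in> space S - ?B n"
      by (intro borel_cantelli_AE1) (auto simp: P.emeasure_eq_measure)
    then show ?thesis
      by (rule AE_mp) (auto intro!: AE_I2 elim!: eventually_mono)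
  qed
  then have "AE z in S. \<forall>k. \<forall>\<^sub>F n in sequentially.
      \<bar>(\<Sum>i<n. ?X i z) / real n - measure M A\<bar> < 1 / real (Suc k)"
    by (simp add: AE_all_countable)
  then show ?thesis
  proof (rule AE_mp, intro AE_I2 impI tendstoI)
    fix z e assume *: "\<forall>k. \<forall>\<^sub>F n in sequentially.
      \<bar>(\<Sum>i<n. ?X i z) / real n - measure M A\<bar> < 1 / real (Suc k)" and "0 < (e :: real)"
    then obtain k where "1 / real (Suc k) < e" using nat_approx_posE by blast
    then show "\<forall>\<^sub>F n in sequentially. dist ((\<Sum>i<n. ?X i z) / real n) (measure M A) < e"
      using *[rule_format, of k] by (auto simp: dist_real_def elim: eventually_mono)
  qed
qed

text \<open>
  Turns the positive drift of a walk, which controls only late times, into a lower bound at all times.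
\<close>

lemma eventually_dominated_imp_bounded_excess:
  fixes f g :: "nat \<Rightarrow> real"
  assumes "\<forall>\<^sub>F t in sequentially. f t \<le> g t"
  obtains C where "\<And>t. f t \<le> C + g t"
proof -
  obtain N where N: "\<And>t. t \<ge> N \<Longrightarrow> f t \<le> g t"
    using assms unfolding eventually_sequentially by blast
  define C where "C = (\<Sum>t<N. \<bar>f t - g t\<bar>)"
  have "f t \<le> C + g t" for t
  proof (cases "t < N")
    case True
    then have "\<bar>f t - g t\<bar> \<le> C" unfolding C_def by (intro member_le_sum) auto
    then show ?thesis by linarith
  next
    case False
    moreover have "0 \<le> C" unfolding C_def by (simp add: sum_nonneg)
    ultimately show ?thesis using N[of t] by simp
  qed
  then show thesis by (rule that)
qed

section \<open>Measurability of the limit\<close>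

lemma real_distribution_veto_empirical: "real_distribution (veto_empirical r x y t)"
  unfolding veto_empirical_def
  by (intro prob_space.real_distribution_distr measure_pmf.prob_space_axioms) simp

lemma mono_cdf: "real_distribution \<nu> \<Longrightarrow> mono (cdf \<nu>)"
  by (intro monoI finite_borel_measure.cdf_nondecreasing real_distribution.finite_borel_measure_M)

lemma cdf_veto_empirical:
  "t \<ge> 1 \<Longrightarrow> cdf (veto_empirical r x y t) v =
    real (size {#s \<in># veto_admitted r x y t. s \<le> v#}) / real (size (veto_admitted r x y t))"
  unfolding cdf_def by (subst measure_veto_empirical) auto

text \<open>
  The default value of \<open>veto_limit\<close> is not a probability measure, so it never equals \<open>\<nu>\<close>.
\<close>

lemma veto_limit_eq_iff:
  assumes "real_distribution \<nu>"
  shows "veto_limit r x y = \<nu> \<longleftrightarrow> weak_conv_m (veto_empirical r x y) \<nu>"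
proof
  assume eq: "veto_limit r x y = \<nu>"
  interpret real_distribution \<nu> by fact
  have "\<nu> \<noteq> null_measure borel"
    using prob_space by (metis measure_null_measure zero_neq_one)
  then obtain \<nu>' where \<nu>': "real_distribution \<nu>'" "weak_conv_m (veto_empirical r x y) \<nu>'"
    using eq unfolding veto_limit_def by (metis (no_types, lifting))
  then show "weak_conv_m (veto_empirical r x y) \<nu>"
    using veto_limit_eqI[OF \<nu>'] eq by simp
qed (rule veto_limit_eqI[OF assms])

text \<open>
  The admission test counts the entries below a random threshold, so the induction on time needs
  measurability of the counts for all measurable thresholds at once.
\<close>

lemma measurable_veto_counts:
  fixes X Y :: "nat \<Rightarrow> 'w \<Rightarrow> real"
  assumes X [measurable]: "\<And>t. t \<ge> 1 \<Longrightarrow> X t \<in> borel_measurable M"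
    and Y [measurable]: "\<And>t. t \<ge> 1 \<Longrightarrow> Y t \<in> borel_measurable M"
  shows "(\<lambda>\<omega>. real (size (veto_admitted r (\<lambda>t. X t \<omega>) (\<lambda>t. Y t \<omega>) t))) \<in> borel_measurable M \<and>
    (\<forall>w\<in>borel_measurable M.
      (\<lambda>\<omega>. real (size {#s \<in># veto_admitted r (\<lambda>t. X t \<omega>) (\<lambda>t. Y t \<omega>) t. s \<le> w \<omega>#})) \<in> borel_measurable M)"
proof (induction t)
  case (Suc t)
  let ?S = "\<lambda>\<omega>. veto_admitted r (\<lambda>t. X t \<omega>) (\<lambda>t. Y t \<omega>) t"
  have [measurable]: "X (Suc t) \<in> borel_measurable M" "Y (Suc t) \<in> borel_measurable M"
    by (auto intro: X Y)
  have [measurable]: "(\<lambda>\<omega>. real (size (?S \<omega>))) \<in> borel_measurable M"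
    using Suc by blast
  have [measurable]: "(\<lambda>\<omega>. real (size {#s \<in># ?S \<omega>. s \<le> (X (Suc t) \<omega> + Y (Suc t) \<omega>) / 2#}))
      \<in> borel_measurable M"
    by (rule Suc[THEN conjunct2, rule_format]) measurable
  show ?case
  proof (intro conjI ballI)
    have "(\<lambda>\<omega>. real (size (?S \<omega>)) +
        (if real (size {#s \<in># ?S \<omega>. s \<le> (X (Suc t) \<omega> + Y (Suc t) \<omega>) / 2#}) \<ge> r * real (size (?S \<omega>))
         then 1 else 0)) \<in> borel_measurable M"
      by measurable
    then show "(\<lambda>\<omega>. real (size (veto_admitted r (\<lambda>t. X t \<omega>) (\<lambda>t. Y t \<omega>) (Suc t)))) \<in> borel_measurable M"
      by (rule measurable_cong[THEN iffD1, rotated]) (simp add: Let_def)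
    fix w :: "'w \<Rightarrow> real" assume w [measurable]: "w \<in> borel_measurable M"
    have [measurable]: "(\<lambda>\<omega>. real (size {#s \<in># ?S \<omega>. s \<le> w \<omega>#})) \<in> borel_measurable M"
      using Suc w by blast
    have "(\<lambda>\<omega>. real (size {#s \<in># ?S \<omega>. s \<le> w \<omega>#}) +
        (if real (size {#s \<in># ?S \<omega>. s \<le> (X (Suc t) \<omega> + Y (Suc t) \<omega>) / 2#}) \<ge> r * real (size (?S \<omega>))
            \<and> min (X (Suc t) \<omega>) (Y (Suc t) \<omega>) \<le> w \<omega>
         then 1 else 0)) \<in> borel_measurable M"
      by measurable
    then show "(\<lambda>\<omega>. real (size {#s \<in># veto_admitted r (\<lambda>t. X t \<omega>) (\<lambda>t. Y t \<omega>) (Suc t). s \<le> w \<omega>#}))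
        \<in> borel_measurable M"
      by (rule measurable_cong[THEN iffD1, rotated]) (simp add: Let_def)
  qed
qed simp

text \<open>
  The value of a measure at a non-measurable set is \<open>0\<close> by default, so this event can have positive
  probability on an arbitrary sample space only because it is measurable.
\<close>

lemma sets_veto_limit_eq:
  fixes X Y :: "nat \<Rightarrow> 'w \<Rightarrow> real"
  assumes X: "\<And>t. t \<ge> 1 \<Longrightarrow> X t \<in> borel_measurable M"
    and Y: "\<And>t. t \<ge> 1 \<Longrightarrow> Y t \<in> borel_measurable M"
    and \<nu>: "real_distribution \<nu>"
  shows "{\<omega> \<in> space M. veto_limit r (\<lambda>t. X t \<omega>) (\<lambda>t. Y t \<omega>) = \<nu>} \<in> sets M"
proof -
  define f where "f t \<omega> v = cdf (veto_empirical r (\<lambda>t. X t \<omega>) (\<lambda>t. Y t \<omega>) t) v" for t \<omega> v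
  have [measurable]: "(\<lambda>\<omega>. f t \<omega> v) \<in> borel_measurable M" for t v
  proof (cases t)
    case 0
    \<comment> \<open>The law of the empty multiset is unspecified, but the same for all \<open>\<omega>\<close>.\<close>
    then show ?thesis by (simp add: f_def veto_empirical_def)
  next
    case (Suc t')
    let ?S = "\<lambda>\<omega>. veto_admitted r (\<lambda>t. X t \<omega>) (\<lambda>t. Y t \<omega>) t"
    have "(\<lambda>\<omega>. real (size (?S \<omega>))) \<in> borel_measurable M"
      "\<forall>w\<in>borel_measurable M. (\<lambda>\<omega>. real (size {#s \<in># ?S \<omega>. s \<le> w \<omega>#})) \<in> borel_measurable M"
      using measurable_veto_counts[of X M Y r t] X Y by blast+
    then have "(\<lambda>\<omega>. real (size {#s \<in># ?S \<omega>. s \<le> v#}) / real (size (?S \<omega>))) \<in> borel_measurable M"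
      by (intro borel_measurable_divide) (auto dest: bspec[where x = "\<lambda>_. v"])
    then show ?thesis
      using Suc by (simp add: f_def cdf_veto_empirical del: veto_admitted.simps)
  qed
  have "veto_limit r (\<lambda>t. X t \<omega>) (\<lambda>t. Y t \<omega>) = \<nu> \<longleftrightarrow>
      (\<forall>a b :: rat. a < b \<longrightarrow> (\<forall>k. \<exists>N. \<forall>n. n \<ge> N \<longrightarrow>
        f n \<omega> (real_of_rat a) < cdf \<nu> (real_of_rat b) + 1 / real (Suc k) \<and>
        cdf \<nu> (real_of_rat a) - 1 / real (Suc k) < f n \<omega> (real_of_rat b)))" for \<omega>
    unfolding veto_limit_eq_iff[OF \<nu>] weak_conv_m_def
    by (subst weak_conv_iff_rational_bounds)
       (auto intro!: mono_cdf real_distribution_veto_empirical \<nu> simp: f_def eventually_sequentially)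
  then show ?thesis
    by simp
qed

section \<open>Trapping the empirical quantile\<close>

definition high_mean :: "real \<Rightarrow> (real \<times> real) set" where
  "high_mean q = {p. q \<le> (fst p + snd p) / 2}"

abbreviation lower :: "real \<times> real \<Rightarrow> real" where
  "lower p \<equiv> min (fst p) (snd p)"

text \<open>
  If the process holds \<open>n\<close> copies of \<open>q\<close> and from then on admits the pairs of \<open>w\<close> with mean
  at least \<open>q\<close>, then at each time \<open>n + (\<Sum>i<t. indicator (high_mean q) (w i))\<close> is the size of the
  multiset, and the two inequalities say that its \<open>r\<close>-quantile equals \<open>q\<close>.
\<close>

definition stays_trapped :: "real \<Rightarrow> real \<Rightarrow> nat \<Rightarrow> (nat \<Rightarrow> real \<times> real) \<Rightarrow> bool" where
  "stays_trapped r q n w \<longleftrightarrow> (\<forall>t.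
     (\<Sum>i<t. indicator {p \<in> high_mean q. lower p < q} (w i))
       < r * (real n + (\<Sum>i<t. indicator (high_mean q) (w i))) \<and>
     r * (real n + (\<Sum>i<t. indicator (high_mean q) (w i)))
       \<le> real n + (\<Sum>i<t. indicator {p \<in> high_mean q. lower p \<le> q} (w i)))"

lemma filter_replicate_mset:
  "filter_mset P (replicate_mset n a) = (if P a then replicate_mset n a else {#})"
  by (induction n) auto

text \<open>
  While the \<open>r\<close>-quantile is \<open>q\<close>, admission is the same as having mean at least \<open>q\<close>. So the
  feedback between admitted values and admission disappears, and all counts are sums of functions of
  the individual pairs.
\<close>

lemma size_veto_admitted_trapped:
  fixes x y :: "nat \<Rightarrow> real" and r q :: real and n t :: nat
  defines "w \<equiv> \<lambda>i. (x (Suc (n + i)), y (Suc (n + i)))"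
  assumes start: "veto_admitted r x y n = replicate_mset n q"
    and stays: "stays_trapped r q n w"
  shows "real (size (filter_mset P (veto_admitted r x y (n + t)))) =
    (if P q then real n else 0) + (\<Sum>i<t. indicator {p \<in> high_mean q. P (lower p)} (w i))"
proof (induction t arbitrary: P)
  case 0
  then show ?case by (simp add: start filter_replicate_mset)
next
  case (Suc t)
  let ?S = "veto_admitted r x y (n + t)" and ?m = "(x (Suc (n + t)) + y (Suc (n + t))) / 2"
  have size: "real (size ?S) = real n + (\<Sum>i<t. indicator (high_mean q) (w i))"
    using Suc[of "\<lambda>_. True"] by simp
  have below: "(\<Sum>i<t. indicator {p \<in> high_mean q. lower p < q} (w i))
        < r * (real n + (\<Sum>i<t. indicator (high_mean q) (w i)))"
    and above: "r * (real n + (\<Sum>i<t. indicator (high_mean q) (w i)))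
        \<le> real n + (\<Sum>i<t. indicator {p \<in> high_mean q. lower p \<le> q} (w i))"
    using stays by (simp_all add: stays_trapped_def)
  \<comment> \<open>The two halves of the trapping condition decide the two directions of the admission test.\<close>
  have adm: "r * real (size ?S) \<le> real (size {#s \<in># ?S. s \<le> ?m#}) \<longleftrightarrow> w t \<in> high_mean q"
  proof (cases "q \<le> ?m")
    case True
    have "r * real (size ?S) \<le> real (size {#s \<in># ?S. s \<le> q#})"
      using above Suc[of "\<lambda>s. s \<le> q"] size by simp
    also have "real (size {#s \<in># ?S. s \<le> q#}) \<le> real (size {#s \<in># ?S. s \<le> ?m#})"
      using True by (intro of_nat_mono size_mset_mono filter_mset_mono_strong) auto
    finally show ?thesis using True by (simp add: w_def high_mean_def)
  next
    case False
    have "real (size {#s \<in># ?S. s \<le> ?m#}) \<le> real (size {#s \<in># ?S. s < q#})"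
      using False by (intro of_nat_mono size_mset_mono filter_mset_mono_strong) auto
    also have "real (size {#s \<in># ?S. s < q#}) < r * real (size ?S)"
      using below Suc[of "\<lambda>s. s < q"] size by simp
    finally show ?thesis using False by (simp add: w_def high_mean_def)
  qed
  have "veto_admitted r x y (n + Suc t) =
      (if w t \<in> high_mean q then add_mset (lower (w t)) ?S else ?S)"
    using adm by (simp add: Let_def w_def)
  then show ?case
    using Suc[of P] by (simp add: indicator_def)
qed

lemma veto_admitted_constant:
  assumes "0 \<le> r" "r \<le> 1" "\<And>i. i < n \<Longrightarrow> x (Suc i) = q \<and> y (Suc i) = q"
  shows "veto_admitted r x y n = replicate_mset n q"
  using assms(3)
proof (induction n)
  case (Suc n)
  then have "veto_admitted r x y n = replicate_mset n q" by simp
  moreover have "x (Suc n) = q" "y (Suc n) = q" using Suc.prems by auto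
  moreover have "r * real n \<le> real n" using assms(2) by (simp add: mult_left_le_one_le assms(1))
  ultimately show ?case by (simp add: filter_replicate_mset)
qed simp

lemma veto_admitted_cong:
  assumes "\<And>i. i < t \<Longrightarrow> x (Suc i) = x' (Suc i) \<and> y (Suc i) = y' (Suc i)"
  shows "veto_admitted r x y t = veto_admitted r x' y' t"
  using assms
proof (induction t)
  case (Suc t)
  then have "veto_admitted r x y t = veto_admitted r x' y' t" by simp
  moreover have "x (Suc t) = x' (Suc t)" "y (Suc t) = y' (Suc t)" using Suc.prems by auto
  ultimately show ?case by (simp add: Let_def)
qed simp

lemma veto_limit_cong:
  assumes "\<And>i. x (Suc i) = x' (Suc i) \<and> y (Suc i) = y' (Suc i)"
  shows "veto_limit r x y = veto_limit r x' y'"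
proof -
  have "veto_empirical r x y = veto_empirical r x' y'"
    unfolding veto_empirical_def using veto_admitted_cong[of _ x x' y y' r] assms by auto
  then show ?thesis unfolding veto_limit_def by (simp only:)
qed

section \<open>The limit law of a trap\<close>

text \<open>
  The last two conditions say, without dividing, that under \<open>trap_law\<close> below the set \<open>{..<q}\<close> has
  probability less than \<open>r\<close> and \<open>{..q}\<close> has probability greater than \<open>r\<close>. Strictness gives
  the drift that keeps the process at \<open>q\<close>.
\<close>

definition veto_trap :: "real \<Rightarrow> real measure \<Rightarrow> real \<Rightarrow> bool" where
  "veto_trap r \<mu> q \<longleftrightarrow>
     0 < measure \<mu> {q} \<and>
     measure (\<mu> \<Otimes>\<^sub>M \<mu>) {p \<in> high_mean q. lower p < q} < r * measure (\<mu> \<Otimes>\<^sub>M \<mu>) (high_mean q) \<and>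
     r * measure (\<mu> \<Otimes>\<^sub>M \<mu>) (high_mean q) < measure (\<mu> \<Otimes>\<^sub>M \<mu>) {p \<in> high_mean q. lower p \<le> q}"

definition trap_law :: "real measure \<Rightarrow> real \<Rightarrow> real measure" where
  "trap_law \<mu> q = distr (uniform_measure (\<mu> \<Otimes>\<^sub>M \<mu>) (high_mean q)) borel lower"

lemma sets_pair_real_distribution:
  assumes "real_distribution \<mu>"
  shows "sets (\<mu> \<Otimes>\<^sub>M \<mu>) = sets (borel \<Otimes>\<^sub>M borel)"
  using real_distribution.events_eq_borel[OF assms] by (intro sets_pair_measure_cong) simp_all

lemma
  assumes "real_distribution \<mu>"
  shows measurable_fst_coordinate:
      "(\<lambda>z. fst (z i)) \<in> borel_measurable (\<Pi>\<^sub>M i\<in>(UNIV :: nat set). \<mu> \<Otimes>\<^sub>M \<mu>)"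
    and measurable_snd_coordinate:
      "(\<lambda>z. snd (z i)) \<in> borel_measurable (\<Pi>\<^sub>M i\<in>(UNIV :: nat set). \<mu> \<Otimes>\<^sub>M \<mu>)"
proof -
  have "(\<lambda>z. z i) \<in> (\<Pi>\<^sub>M i\<in>(UNIV :: nat set). \<mu> \<Otimes>\<^sub>M \<mu>) \<rightarrow>\<^sub>M \<mu> \<Otimes>\<^sub>M \<mu>"
    by (rule measurable_component_singleton) simp
  then have "(\<lambda>z. z i) \<in> (\<Pi>\<^sub>M i\<in>(UNIV :: nat set). \<mu> \<Otimes>\<^sub>M \<mu>) \<rightarrow>\<^sub>M borel \<Otimes>\<^sub>M borel"
    by (simp add: measurable_cong_sets[OF refl sets_pair_real_distribution[OF assms]])
  from measurable_compose[OF this measurable_fst] measurable_compose[OF this measurable_snd]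
  show "(\<lambda>z. fst (z i)) \<in> borel_measurable (\<Pi>\<^sub>M i\<in>(UNIV :: nat set). \<mu> \<Otimes>\<^sub>M \<mu>)"
    and "(\<lambda>z. snd (z i)) \<in> borel_measurable (\<Pi>\<^sub>M i\<in>(UNIV :: nat set). \<mu> \<Otimes>\<^sub>M \<mu>)" .
qed

lemma borel_sets_high_mean [measurable]: "high_mean q \<in> sets (borel \<Otimes>\<^sub>M borel)"
proof -
  have "{p \<in> space (borel \<Otimes>\<^sub>M borel). q \<le> (fst p + snd p) / 2} \<in> sets (borel \<Otimes>\<^sub>M borel)"
    by measurable
  then show ?thesis by (simp add: high_mean_def space_pair_measure)
qed

lemma borel_sets_high_mean_lower:
  assumes "B \<in> sets borel"
  shows "{p \<in> high_mean q. lower p \<in> B} \<in> sets (borel \<Otimes>\<^sub>M borel)"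
proof -
  note [measurable] = assms
  have "{p \<in> space (borel \<Otimes>\<^sub>M borel). p \<in> high_mean q \<and> lower p \<in> B} \<in> sets (borel \<Otimes>\<^sub>M borel)"
    by measurable
  then show ?thesis by (simp add: space_pair_measure)
qed

context
  fixes r q :: real and \<mu> :: "real measure"
  assumes \<mu>: "real_distribution \<mu>" and r: "0 < r" "r < 1" and trap: "veto_trap r \<mu> q"
begin

interpretation \<mu>: real_distribution \<mu> by (rule \<mu>)

interpretation P: pair_prob_space \<mu> \<mu> ..

interpretation S: sequence_space "\<mu> \<Otimes>\<^sub>M \<mu>" ..

lemmas [measurable_cong] = sets_pair_real_distribution[OF \<mu>]

lemma high_mean_pos: "0 < measure (\<mu> \<Otimes>\<^sub>M \<mu>) (high_mean q)"
proof -
  have "0 \<le> measure (\<mu> \<Otimes>\<^sub>M \<mu>) {p \<in> high_mean q. lower p < q}" by simp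
  also have "\<dots> < r * measure (\<mu> \<Otimes>\<^sub>M \<mu>) (high_mean q)"
    using trap by (simp add: veto_trap_def)
  finally show ?thesis using r(1) by (simp add: zero_less_mult_iff)
qed

lemma real_distribution_trap_law: "real_distribution (trap_law \<mu> q)"
proof -
  have "prob_space (uniform_measure (\<mu> \<Otimes>\<^sub>M \<mu>) (high_mean q))"
    using high_mean_pos by (intro prob_space_uniform_measure) (auto simp: P.emeasure_eq_measure)
  then show ?thesis
    unfolding trap_law_def by (intro prob_space.real_distribution_distr) measurable
qed

lemma measure_trap_law:
  assumes B [measurable]: "B \<in> sets borel"
  shows "measure (trap_law \<mu> q) B =
    measure (\<mu> \<Otimes>\<^sub>M \<mu>) {p \<in> high_mean q. lower p \<in> B} / measure (\<mu> \<Otimes>\<^sub>M \<mu>) (high_mean q)"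
proof -
  have "measure (trap_law \<mu> q) B = measure (uniform_measure (\<mu> \<Otimes>\<^sub>M \<mu>) (high_mean q)) (lower -` B)"
    unfolding trap_law_def by (subst measure_distr) (auto simp: space_pair_measure)
  also have "lower -` B \<inter> space (borel \<Otimes>\<^sub>M borel) \<in> sets (borel \<Otimes>\<^sub>M borel)"
    by (rule measurable_sets[OF _ B]) measurable
  then have "lower -` B \<in> sets (\<mu> \<Otimes>\<^sub>M \<mu>)"
    by (simp add: sets_pair_real_distribution[OF \<mu>] space_pair_measure)
  then have "measure (uniform_measure (\<mu> \<Otimes>\<^sub>M \<mu>) (high_mean q)) (lower -` B) =
      measure (\<mu> \<Otimes>\<^sub>M \<mu>) (high_mean q \<inter> lower -` B) / measure (\<mu> \<Otimes>\<^sub>M \<mu>) (high_mean q)"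
    using high_mean_pos by (intro measure_uniform_measure) (auto simp: P.emeasure_eq_measure)
  also have "high_mean q \<inter> lower -` B = {p \<in> high_mean q. lower p \<in> B}" by auto
  finally show ?thesis .
qed

lemma trap_law_quantile:
  "measure (trap_law \<mu> q) {..<q} < r" "r < measure (trap_law \<mu> q) {..q}"
  using trap high_mean_pos by (simp_all add: measure_trap_law veto_trap_def field_simps)

text \<open>
  Both inequalities of \<open>stays_trapped\<close> compare walks whose drifts differ strictly at a trap, so almost
  surely they fail by at most a bounded amount, and a large \<open>n\<close> makes up for it.
\<close>

lemma AE_stays_trapped: "AE w in S.S. \<exists>n\<ge>1. stays_trapped r q n w"
proof -
  let ?P = "measure (\<mu> \<Otimes>\<^sub>M \<mu>)" and ?A = "high_mean q"
  let ?L = "{p \<in> high_mean q. lower p < q}" and ?U = "{p \<in> high_mean q. lower p \<le> q}"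
  have sets: "?A \<in> sets (\<mu> \<Otimes>\<^sub>M \<mu>)" "?L \<in> sets (\<mu> \<Otimes>\<^sub>M \<mu>)" "?U \<in> sets (\<mu> \<Otimes>\<^sub>M \<mu>)"
    using borel_sets_high_mean borel_sets_high_mean_lower[of "{..<q}" q]
      borel_sets_high_mean_lower[of "{..q}" q]
    by (simp_all add: sets_pair_real_distribution[OF \<mu>])
  show ?thesis
    using S.AE_frequency_tendsto[OF sets(1)] S.AE_frequency_tendsto[OF sets(2)]
      S.AE_frequency_tendsto[OF sets(3)]
  proof eventually_elim
    case (elim w)
    let ?a = "\<lambda>t. \<Sum>i<t. indicator ?A (w i) :: real"
    let ?l = "\<lambda>t. \<Sum>i<t. indicator ?L (w i) :: real"
    let ?u = "\<lambda>t. \<Sum>i<t. indicator ?U (w i) :: real"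
    have lim: "(\<lambda>t. r * (?a t / real t) - ?l t / real t) \<longlonglongrightarrow> r * ?P ?A - ?P ?L"
      "(\<lambda>t. ?u t / real t - r * (?a t / real t)) \<longlonglongrightarrow> ?P ?U - r * ?P ?A"
      by (intro tendsto_intros elim)+
    have "0 < r * ?P ?A - ?P ?L" "0 < ?P ?U - r * ?P ?A"
      using trap unfolding veto_trap_def by linarith+
    note gt = order_tendstoD(1)[OF lim(1) this(1)] order_tendstoD(1)[OF lim(2) this(2)]
    have ev: "\<forall>\<^sub>F t in sequentially. ?l t \<le> r * ?a t" "\<forall>\<^sub>F t in sequentially. r * ?a t \<le> ?u t"
      using gt eventually_gt_at_top[of 0] by (eventually_elim, simp add: field_simps)+
    obtain C where C: "\<And>t. ?l t \<le> C + r * ?a t"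
      using eventually_dominated_imp_bounded_excess[OF ev(1)] by blast
    obtain D where D: "\<And>t. r * ?a t \<le> D + ?u t"
      using eventually_dominated_imp_bounded_excess[OF ev(2)] by blast
    \<comment> \<open>The initial copies give a lead of r n in the first inequality and (1 - r) n in the second.\<close>
    define n where "n = Suc (nat \<lceil>max (C / r) (D / (1 - r))\<rceil>)"
    have "C / r < real n" "D / (1 - r) < real n" unfolding n_def by linarith+
    then have n: "C < r * real n" "D < (1 - r) * real n"
      using r by (simp_all add: field_simps)
    have "stays_trapped r q n w"
      unfolding stays_trapped_def
    proof (intro allI conjI)
      fix t
      show "?l t < r * (real n + ?a t)"
        using C[of t] n(1) by (simp add: algebra_simps)
      show "r * (real n + ?a t) \<le> real n + ?u t"
        using D[of t] n(2) by (simp add: algebra_simps)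
    qed
    then show ?case unfolding n_def by (intro exI[of _ n]) (simp add: n_def)
  qed
qed

text \<open>
  The \<open>n\<close> initial copies are negligible in the limit, so the empirical distribution function converges
  to the ratio of the two limiting frequencies.
\<close>

lemma veto_limit_trapped:
  fixes x y :: "nat \<Rightarrow> real" and n :: nat
  defines "w \<equiv> \<lambda>i. (x (Suc (n + i)), y (Suc (n + i)))"
  assumes n: "n \<ge> 1" and start: "veto_admitted r x y n = replicate_mset n q"
    and stays: "stays_trapped r q n w"
    and freq: "(\<lambda>t. (\<Sum>i<t. indicator (high_mean q) (w i)) / real t)
      \<longlonglongrightarrow> measure (\<mu> \<Otimes>\<^sub>M \<mu>) (high_mean q)"
    and freq_le: "\<And>v :: rat. (\<lambda>t. (\<Sum>i<t. indicator {p \<in> high_mean q. lower p \<le> real_of_rat v} (w i)) / real t)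
      \<longlonglongrightarrow> measure (\<mu> \<Otimes>\<^sub>M \<mu>) {p \<in> high_mean q. lower p \<le> real_of_rat v}"
  shows "veto_limit r x y = trap_law \<mu> q"
proof (rule veto_limit_eqI[OF real_distribution_trap_law])
  let ?E = "veto_empirical r x y"
  have count: "real (size (filter_mset P (veto_admitted r x y (n + t)))) =
      (if P q then real n else 0) + (\<Sum>i<t. indicator {p \<in> high_mean q. P (lower p)} (w i))" for P t
    unfolding w_def by (rule size_veto_admitted_trapped[OF start stays[unfolded w_def]])
  have "(\<lambda>t. cdf (?E (t + n)) (real_of_rat v)) \<longlonglongrightarrow> cdf (trap_law \<mu> q) (real_of_rat v)" for v
  proof -
    let ?k = "if q \<le> real_of_rat v then real n else 0"
    let ?a = "\<lambda>t. \<Sum>i<t. indicator (high_mean q) (w i) :: real"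
    let ?c = "\<lambda>t. \<Sum>i<t. indicator {p \<in> high_mean q. lower p \<le> real_of_rat v} (w i) :: real"
    \<comment> \<open>The stock of n initial copies contributes terms of order 1/t to both counts.\<close>
    have "(\<lambda>t. (?k / real t + ?c t / real t) / (real n / real t + ?a t / real t)) \<longlonglongrightarrow>
        (0 + measure (\<mu> \<Otimes>\<^sub>M \<mu>) {p \<in> high_mean q. lower p \<le> real_of_rat v}) /
        (0 + measure (\<mu> \<Otimes>\<^sub>M \<mu>) (high_mean q))"
      by (intro tendsto_divide tendsto_add freq freq_le lim_const_over_n) (use high_mean_pos in simp)
    then have lim: "(\<lambda>t. (?k / real t + ?c t / real t) / (real n / real t + ?a t / real t)) \<longlonglongrightarrow>
        cdf (trap_law \<mu> q) (real_of_rat v)"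
      by (simp add: cdf_def measure_trap_law)
    have eq: "cdf (?E (t + n)) (real_of_rat v) = (?k + ?c t) / (real n + ?a t)" for t
    proof -
      have "real (size (veto_admitted r x y (n + t))) = real n + ?a t"
        using count[of "\<lambda>_. True" t] by simp
      then show ?thesis
        using n count[of "\<lambda>s. s \<le> real_of_rat v" t] by (simp add: cdf_veto_empirical add.commute)
    qed
    show ?thesis
      by (rule Lim_transform_eventually[OF lim])
        (use eventually_gt_at_top[of 0] in eventually_elim,
         simp add: eq add_divide_distrib[symmetric])
  qed
  then show "weak_conv_m ?E (trap_law \<mu> q)"
    unfolding weak_conv_m_def
    by (intro weak_conv_if_tendsto_rational mono_cdf real_distribution_veto_empirical
        real_distribution_trap_law) (rule LIMSEQ_offset)
qed

text \<open>
  The sequence is split after its first \<open>n\<close> pairs: by \<open>PiM_comb_seq\<close> these are independent of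
  the remaining pairs, and the latter again form an independent sequence. The argument by contradiction
  with almost sure statements avoids having to show that the set of good continuations is measurable.
\<close>

lemma prob_trap_limit_pos:
  "0 < measure S.S {z \<in> space S.S.
    veto_limit r (\<lambda>t. fst (z (t - 1))) (\<lambda>t. snd (z (t - 1))) = trap_law \<mu> q}"
    (is "0 < measure _ ?L")
proof -
  interpret SS: pair_prob_space S.S S.S ..
  let ?P = "\<mu> \<Otimes>\<^sub>M \<mu>"
  let ?freq = "\<lambda>B w. (\<lambda>t. (\<Sum>i<t. indicator B (w i)) / real t) \<longlonglongrightarrow> measure ?P B"
  define good where "good n w \<longleftrightarrow> stays_trapped r q n w \<and> ?freq (high_mean q) w \<and>
    (\<forall>v :: rat. ?freq {p \<in> high_mean q. lower p \<le> real_of_rat v} w)" for n w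
  have "AE w in S.S. ?freq (high_mean q) w"
    by (rule S.AE_frequency_tendsto) measurable
  moreover have "AE w in S.S. \<forall>v :: rat. ?freq {p \<in> high_mean q. lower p \<le> real_of_rat v} w"
    unfolding AE_all_countable
  proof
    fix v :: rat
    have "{p \<in> high_mean q. lower p \<le> real_of_rat v} \<in> sets ?P"
      using borel_sets_high_mean_lower[of "{..real_of_rat v}" q]
      by (simp add: sets_pair_real_distribution[OF \<mu>])
    then show "AE w in S.S. ?freq {p \<in> high_mean q. lower p \<le> real_of_rat v} w"
      by (rule S.AE_frequency_tendsto)
  qed
  ultimately have AE_good: "AE w in S.S. \<exists>n\<ge>1. good n w"
    using AE_stays_trapped by eventually_elim (auto simp: good_def)
  \<comment> \<open>Countably many values of n exhaust the space, so one of them is good with positive probability.\<close>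
  have "\<exists>n\<ge>1. \<not> (AE w in S.S. \<not> good n w)"
  proof (rule ccontr)
    assume "\<not> ?thesis"
    then have "AE w in S.S. \<forall>n. n \<ge> 1 \<longrightarrow> \<not> good n w"
      by (auto simp: AE_all_countable)
    then have "AE w in S.S. False"
      using AE_good by eventually_elim blast
    then show False by simp
  qed
  then obtain n where n: "n \<ge> 1" "\<not> (AE w in S.S. \<not> good n w)" by blast
  have L [measurable]: "?L \<in> sets S.S"
    by (intro sets_veto_limit_eq measurable_fst_coordinate measurable_snd_coordinate \<mu>
        real_distribution_trap_law)
  show ?thesis
  proof (rule ccontr)
    assume "\<not> 0 < measure S.S ?L"
    then have "measure S.S ?L = 0" by (simp add: not_less measure_le_0_iff)
    then have "AE z in S.S. z \<notin> ?L"
      using L by (intro AE_not_in) (simp add: null_sets_def S.P.emeasure_eq_measure)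
    then have "AE z in distr (S.S \<Otimes>\<^sub>M S.S) S.S (\<lambda>(\<omega>, \<omega>'). comb_seq n \<omega> \<omega>'). z \<notin> ?L"
      by (simp only: S.PiM_comb_seq)
    then have "AE z in S.S \<Otimes>\<^sub>M S.S. (\<lambda>(\<omega>, \<omega>'). comb_seq n \<omega> \<omega>') z \<notin> ?L"
      by (rule AE_distrD[OF measurable_comb_seq])
    from SS.AE_pair[OF this] have AE: "AE \<omega> in S.S. AE \<omega>' in S.S. comb_seq n \<omega> \<omega>' \<notin> ?L"
      by (simp only: case_prod_conv)
    let ?E = "prod_emb UNIV (\<lambda>_. ?P) {..<n} (\<Pi>\<^sub>E i\<in>{..<n}. {(q, q)})"
    have qq: "{(q, q)} \<in> sets ?P"
      using pair_measureI[of "{q}" \<mu> "{q}" \<mu>] by simp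
    have "measure ?P {(q, q)} = measure \<mu> {q} * measure \<mu> {q}"
      using \<mu>.emeasure_pair_measure_Times[of "{q}" \<mu> "{q}"] by (simp add: measure_def enn2real_mult)
    then have "0 < measure S.S ?E"
      using trap qq by (subst S.measure_PiM_emb) (simp_all add: veto_trap_def)
    moreover have "?E \<in> sets S.S"
      using qq by (intro sets_PiM_I) simp_all
    ultimately have E: "\<not> (AE \<omega> in S.S. \<omega> \<notin> ?E)"
      by (subst AE_iff_null_sets[symmetric]) (simp_all add: null_sets_def S.P.emeasure_eq_measure)
    have "\<exists>\<omega>\<in>?E. AE \<omega>' in S.S. comb_seq n \<omega> \<omega>' \<notin> ?L"
    proof (rule ccontr)
      assume none: "\<not> ?thesis"
      have "AE \<omega> in S.S. \<omega> \<notin> ?E"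
        using AE by eventually_elim (use none in blast)
      then show False using E by blast
    qed
    then obtain \<omega> where \<omega>: "\<omega> \<in> ?E" "AE \<omega>' in S.S. comb_seq n \<omega> \<omega>' \<notin> ?L"
      by blast
    have q: "\<omega> i = (q, q)" if "i < n" for i
    proof -
      have "restrict \<omega> {..<n} \<in> (\<Pi>\<^sub>E i\<in>{..<n}. {(q, q)})"
        using \<omega>(1) unfolding prod_emb_def by blast
      from PiE_mem[OF this, of i] that show ?thesis by simp
    qed
    have "AE w in S.S. \<not> good n w"
      using \<omega>(2) AE_space
    proof eventually_elim
      case (elim w)
      have "veto_limit r (\<lambda>t. fst (comb_seq n \<omega> w (t - 1))) (\<lambda>t. snd (comb_seq n \<omega> w (t - 1))) = trap_law \<mu> q"
        if "good n w"
        by (rule veto_limit_trapped[OF n(1)])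
          (use that r in \<open>auto simp: good_def comb_seq_def q intro!: veto_admitted_constant\<close>)
      moreover have "comb_seq n \<omega> w \<in> space S.S"
        by (simp add: space_PiM space_pair_measure)
      ultimately show ?case using elim by auto
    qed
    then show False using n(2) by blast
  qed
qed

end

text \<open>
  The \<open>r\<close>-quantile recovers the trap from its law.
\<close>

lemma trap_law_neq:
  assumes "real_distribution \<mu>" "0 < r" "r < 1" "veto_trap r \<mu> p" "veto_trap r \<mu> q" "p < q"
  shows "trap_law \<mu> p \<noteq> trap_law \<mu> q"
proof
  assume eq: "trap_law \<mu> p = trap_law \<mu> q"
  interpret real_distribution "trap_law \<mu> q" by (rule real_distribution_trap_law) fact+
  have "r < measure (trap_law \<mu> q) {..p}"
    using trap_law_quantile(2)[OF assms(1-4)] by (simp add: eq)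
  also have "\<dots> \<le> measure (trap_law \<mu> q) {..<q}"
    using assms(6) by (intro finite_measure_mono) auto
  also have "\<dots> < r"
    using trap_law_quantile(1)[OF assms(1-3,5)] .
  finally show False .
qed

section \<open>Reduction to the product space of sequences\<close>

text \<open>
  The limit is a function of the input pairs at times \<open>1, 2, \<dots>\<close> only, and their joint law is determined
  by \<open>veto_inputs\<close>. The shift by one in the index makes the sequence start at \<open>0\<close>.
\<close>

lemma veto_inputs_prob_limit:
  fixes M :: "'w measure" and X Y :: "nat \<Rightarrow> 'w \<Rightarrow> real"
  assumes \<mu>: "real_distribution \<mu>" and \<nu>: "real_distribution \<nu>" and inp: "veto_inputs M \<mu> X Y"
  defines "S \<equiv> \<Pi>\<^sub>M i\<in>(UNIV :: nat set). \<mu> \<Otimes>\<^sub>M \<mu>"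
  shows "\<P>(\<omega> in M. veto_limit r (\<lambda>t. X t \<omega>) (\<lambda>t. Y t \<omega>) = \<nu>) =
    measure S {z \<in> space S. veto_limit r (\<lambda>t. fst (z (t - 1))) (\<lambda>t. snd (z (t - 1))) = \<nu>}"
    (is "_ = measure S ?L")
proof -
  interpret \<mu>: real_distribution \<mu> by fact
  interpret P: pair_prob_space \<mu> \<mu> ..
  interpret M: prob_space M using inp by (simp add: veto_inputs_def)
  note [measurable_cong] = sets_pair_real_distribution[OF \<mu>]
  let ?W = "borel \<Otimes>\<^sub>M borel :: (real \<times> real) measure"
  let ?V = "\<lambda>t \<omega>. (X t \<omega>, Y t \<omega>)"
  define Z where "Z \<omega> = (\<lambda>i. ?V (Suc i) \<omega>)" for \<omega>
  have ind: "M.indep_var borel (X t) borel (Y t)"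
    and X: "distr M borel (X t) = \<mu>" and Y: "distr M borel (Y t) = \<mu>" if "t \<ge> 1" for t
    using inp that by (auto simp: veto_inputs_def)
  have rv [measurable]: "X t \<in> borel_measurable M" "Y t \<in> borel_measurable M" if "t \<ge> 1" for t
    using M.indep_var_rv1[OF ind[OF that]] M.indep_var_rv2[OF ind[OF that]] .
  have pair: "distr M ?W (?V t) = \<mu> \<Otimes>\<^sub>M \<mu>" if "t \<ge> 1" for t
    using ind[OF that] X[OF that] Y[OF that] unfolding M.indep_var_distribution_eq by metis
  have "distr M (\<Pi>\<^sub>M i\<in>{1..}. ?W) (\<lambda>\<omega>. \<lambda>i\<in>{1..}. ?V i \<omega>) = (\<Pi>\<^sub>M i\<in>{1..}. distr M ?W (?V i))"
    using inp by (subst M.indep_vars_iff_distr_eq_PiM'[symmetric]) (auto simp: veto_inputs_def)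
  also have "\<dots> = (\<Pi>\<^sub>M i\<in>{1..}. \<mu> \<Otimes>\<^sub>M \<mu>)"
    by (intro PiM_cong) (auto simp: pair)
  finally have joint: "distr M (\<Pi>\<^sub>M i\<in>{1..}. ?W) (\<lambda>\<omega>. \<lambda>i\<in>{1..}. ?V i \<omega>) = (\<Pi>\<^sub>M i\<in>{1..}. \<mu> \<Otimes>\<^sub>M \<mu>)" .
  have Z: "Z \<in> M \<rightarrow>\<^sub>M S"
    unfolding S_def
  proof (rule measurable_PiM_single')
    fix i :: nat
    have "(\<lambda>\<omega>. ?V (Suc i) \<omega>) \<in> M \<rightarrow>\<^sub>M ?W"
      by (intro measurable_Pair rv) simp_all
    then show "(\<lambda>\<omega>. Z \<omega> i) \<in> M \<rightarrow>\<^sub>M \<mu> \<Otimes>\<^sub>M \<mu>"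
      by (simp add: Z_def measurable_cong_sets[OF refl sets_pair_real_distribution[OF \<mu>]])
  qed (auto simp: space_pair_measure)
  have "distr M S Z = distr (distr M (\<Pi>\<^sub>M i\<in>{1..}. ?W) (\<lambda>\<omega>. \<lambda>i\<in>{1..}. ?V i \<omega>)) S (\<lambda>\<omega>. \<lambda>n\<in>UNIV. \<omega> (Suc n))"
  proof (subst distr_distr)
    show "(\<lambda>\<omega>. \<lambda>n\<in>UNIV. \<omega> (Suc n)) \<in> (\<Pi>\<^sub>M i\<in>{1..}. ?W) \<rightarrow>\<^sub>M S"
      unfolding S_def
    proof (rule measurable_restrict)
      fix n :: nat
      have "(\<lambda>\<omega>. \<omega> (Suc n)) \<in> (\<Pi>\<^sub>M i\<in>{1..}. ?W) \<rightarrow>\<^sub>M ?W"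
        by (rule measurable_component_singleton) simp
      then show "(\<lambda>\<omega>. \<omega> (Suc n)) \<in> (\<Pi>\<^sub>M i\<in>{1..}. ?W) \<rightarrow>\<^sub>M \<mu> \<Otimes>\<^sub>M \<mu>"
        by (simp add: measurable_cong_sets[OF refl sets_pair_real_distribution[OF \<mu>]])
    qed
    show "(\<lambda>\<omega>. \<lambda>i\<in>{1..}. ?V i \<omega>) \<in> M \<rightarrow>\<^sub>M (\<Pi>\<^sub>M i\<in>{1..}. ?W)"
      by measurable
  qed (simp add: comp_def Z_def[abs_def] restrict_UNIV)
  also have "\<dots> = S"
    unfolding joint S_def
    using distr_PiM_reindex[of "{1..}" "\<lambda>_. \<mu> \<Otimes>\<^sub>M \<mu>" Suc UNIV] P.prob_space_axioms by auto
  finally have distr: "distr M S Z = S" .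
  have L: "?L \<in> sets S"
    unfolding S_def
    by (intro sets_veto_limit_eq measurable_fst_coordinate measurable_snd_coordinate \<mu> \<nu>)
  have "measure S ?L = measure (distr M S Z) ?L" by (simp only: distr)
  also have "\<dots> = measure M (Z -` ?L \<inter> space M)"
    by (rule measure_distr[OF Z L])
  also have "Z -` ?L \<inter> space M = {\<omega> \<in> space M. veto_limit r (\<lambda>t. X t \<omega>) (\<lambda>t. Y t \<omega>) = \<nu>}"
  proof -
    have "veto_limit r (\<lambda>t. fst (Z \<omega> (t - 1))) (\<lambda>t. snd (Z \<omega> (t - 1))) =
        veto_limit r (\<lambda>t. X t \<omega>) (\<lambda>t. Y t \<omega>)" for \<omega>
      by (rule veto_limit_cong) (simp add: Z_def)
    then show ?thesis using measurable_space[OF Z] by auto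
  qed
  finally show ?thesis by simp
qed

section \<open>A distribution with infinitely many traps\<close>

text \<open>
  On \<open>high_mean q\<close> a minimum below \<open>q\<close> forces one of the two values above \<open>q\<close>, and a minimum
  above \<open>q\<close> forces both, while \<open>(q, q)\<close> belongs to \<open>high_mean q\<close>.
\<close>

lemma veto_trap_if_light_tail:
  assumes \<mu>: "real_distribution \<mu>" and r: "0 < r" "r < 1"
    and tail: "2 * measure \<mu> {q<..} < min r (1 - r) * (measure \<mu> {q})\<^sup>2"
  shows "veto_trap r \<mu> q"
proof -
  interpret \<mu>: real_distribution \<mu> by fact
  interpret P: pair_prob_space \<mu> \<mu> ..
  let ?P = "measure (\<mu> \<Otimes>\<^sub>M \<mu>)" and ?A = "high_mean q" and ?m = "(measure \<mu> {q})\<^sup>2"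
  let ?X = "{q<..} \<times> (UNIV :: real set)" and ?Y = "(UNIV :: real set) \<times> {q<..}"
  have rect: "?P (B \<times> C) = measure \<mu> B * measure \<mu> C" if "B \<in> sets borel" "C \<in> sets borel" for B C
    using \<mu>.emeasure_pair_measure_Times[of B \<mu> C] that by (simp add: measure_def enn2real_mult)
  have sets_rect: "B \<times> C \<in> sets (\<mu> \<Otimes>\<^sub>M \<mu>)" if "B \<in> sets borel" "C \<in> sets borel" for B C
    using that by (intro pair_measureI) simp_all
  have sets: "?A \<in> sets (\<mu> \<Otimes>\<^sub>M \<mu>)" "{p \<in> ?A. lower p \<le> q} \<in> sets (\<mu> \<Otimes>\<^sub>M \<mu>)"
    "{p \<in> ?A. lower p < q} \<in> sets (\<mu> \<Otimes>\<^sub>M \<mu>)"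
    using borel_sets_high_mean borel_sets_high_mean_lower[of "{..q}" q]
      borel_sets_high_mean_lower[of "{..<q}" q]
    by (simp_all add: sets_pair_real_distribution[OF \<mu>])
  have one: "measure \<mu> UNIV = 1" using \<mu>.prob_space by simp
  have "?m = ?P ({q} \<times> {q})" by (subst rect) (simp_all add: power2_eq_square)
  also have "\<dots> \<le> ?P ?A"
    using sets by (intro P.finite_measure_mono) (auto simp: high_mean_def)
  finally have m: "?m \<le> ?P ?A" .
  have "?P {p \<in> ?A. lower p < q} \<le> ?P (?X \<union> ?Y)"
    using sets_rect by (intro P.finite_measure_mono) (auto simp: high_mean_def)
  also have "\<dots> \<le> ?P ?X + ?P ?Y"
    using sets_rect by (intro measure_Un_le) auto
  also have "\<dots> = 2 * measure \<mu> {q<..}" by (simp add: rect one)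
  also have "\<dots> < min r (1 - r) * ?m" by (rule tail)
  also have "\<dots> \<le> r * ?P ?A" using r m by (intro mult_mono) auto
  finally have low: "?P {p \<in> ?A. lower p < q} < r * ?P ?A" .
  have "?P ?A \<le> ?P ({p \<in> ?A. lower p \<le> q} \<union> ?X)"
    using sets sets_rect by (intro P.finite_measure_mono) auto
  also have "\<dots> \<le> ?P {p \<in> ?A. lower p \<le> q} + ?P ?X"
    using sets sets_rect by (intro measure_Un_le) auto
  also have "?P ?X = measure \<mu> {q<..}" by (simp add: rect one)
  also have "measure \<mu> {q<..} \<le> 2 * measure \<mu> {q<..}" by simp
  also have "\<dots> < min r (1 - r) * ?m" by (rule tail)
  also have "min r (1 - r) * ?m \<le> (1 - r) * ?P ?A" using r m by (intro mult_mono) auto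
  finally have high: "r * ?P ?A < ?P {p \<in> ?A. lower p \<le> q}" by (simp add: algebra_simps)
  have "measure \<mu> {q} \<noteq> 0"
  proof
    assume "measure \<mu> {q} = 0"
    then have "measure \<mu> {q<..} < 0" using tail by simp
    then show False using measure_nonneg[of \<mu> "{q<..}"] by linarith
  qed
  then have "0 < measure \<mu> {q}" by (simp add: zero_less_measure_iff)
  then show ?thesis using low high by (simp add: veto_trap_def)
qed

text \<open>
  The tails \<open>T k\<close>, the masses of \<open>{k..}\<close>, are chosen with \<open>T (Suc k) = c * (T k)\<^sup>2\<close>. Then at least
  half of each tail sits at its first point, and what follows is of the order of the square of that mass.
\<close>

lemma ex_pmf_light_tail:
  fixes m :: real
  assumes "0 < m" "m \<le> 1"
  obtains p :: "nat pmf" where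
    "\<And>k. 2 * measure_pmf.prob p {k<..} < m * (pmf p k)\<^sup>2"
proof -
  \<comment> \<open>With \<open>f k \<ge> T k / 2\<close> the claim \<open>2 * T (Suc k) < m * (f k)\<^sup>2\<close> follows from \<open>2 * c < m / 4\<close>.\<close>
  define c where "c = m / 16"
  define T where "T k = c ^ (2 ^ k) / c" for k :: nat
  define f where "f k = T k - T (Suc k)" for k
  have c: "0 < c" "c \<le> 1 / 16" using assms by (auto simp: c_def)
  have T0: "T 0 = 1" using c by (simp add: T_def)
  have T_Suc: "T (Suc k) = c * (T k)\<^sup>2" for k
    using c by (simp add: T_def power2_eq_square power_add[symmetric] mult_2)
  have T_pos: "0 < T k" for k using c by (simp add: T_def)
  have T_le: "T k \<le> 1" for k
  proof (induction k)
    case (Suc k)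
    have "c * (T k)\<^sup>2 \<le> 1 * 1"
      using c Suc T_pos[of k] by (intro mult_mono power_le_one) auto
    then show ?case by (simp add: T_Suc)
  qed (simp add: T0)
  have f_ge: "T k / 2 \<le> f k" for k
  proof -
    have "c * T k \<le> 1 / 2 * 1" using c T_le[of k] T_pos[of k] by (intro mult_mono) auto
    then have "c * T k * T k \<le> 1 / 2 * T k" using T_pos[of k] by (intro mult_right_mono) auto
    then show ?thesis by (simp add: f_def T_Suc power2_eq_square mult.assoc)
  qed
  have f_nonneg: "0 \<le> f k" for k using f_ge[of k] T_pos[of k] by linarith
  have "(\<lambda>k. c ^ (2 ^ k)) \<longlonglongrightarrow> 0"
    using LIMSEQ_subseq_LIMSEQ[of "\<lambda>n. c ^ n" 0 "\<lambda>k. 2 ^ k"] c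
    by (simp add: comp_def strict_mono_def LIMSEQ_power_zero)
  then have "T \<longlonglongrightarrow> 0"
    unfolding T_def using tendsto_divide[OF _ tendsto_const, of _ 0 sequentially c] c by fastforce
  from telescope_sums'[OF this] have sums: "f sums 1" by (simp add: f_def[abs_def] T0)
  have total: "(\<integral>\<^sup>+k. ennreal (f k) \<partial>count_space UNIV) = 1"
    using suminf_ennreal2[OF f_nonneg sums_summable[OF sums]] sums_unique[OF sums]
    by (simp add: nn_integral_count_space_nat)
  define p where "p = embed_pmf f"
  have pmf: "pmf p k = f k" for k
    unfolding p_def by (rule pmf_embed_pmf[OF f_nonneg total])
  have tail: "measure_pmf.prob p {k<..} = T (Suc k)" for k
  proof -
    have "measure_pmf.prob p {..k} = (\<Sum>i\<le>k. f i)"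
      by (simp add: measure_measure_pmf_finite pmf)
    also have "\<dots> = 1 - T (Suc k)"
      unfolding f_def by (subst sum_telescope) (simp add: T0)
    finally have "measure_pmf.prob p (UNIV - {..k}) = T (Suc k)"
      using measure_pmf.prob_compl[of "{..k}" p] by simp
    moreover have "UNIV - {..k} = {k<..}" by auto
    ultimately show ?thesis by simp
  qed
  show thesis
  proof (rule that)
    fix k
    have "2 * T (Suc k) = m * (T k)\<^sup>2 / 8" by (simp add: T_Suc c_def)
    also have "\<dots> < m * (T k)\<^sup>2 / 4"
      using assms(1) T_pos[of k] by simp
    also have "\<dots> = m * (T k / 2)\<^sup>2" by (simp add: power_divide)
    also have "\<dots> \<le> m * (f k)\<^sup>2"
      using assms(1) f_ge[of k] T_pos[of k] by (intro mult_left_mono power_mono) auto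
    finally show "2 * measure_pmf.prob p {k<..} < m * (pmf p k)\<^sup>2"
      by (simp add: tail pmf)
  qed
qed

lemma infinite_veto_limit_atoms:
  fixes M :: "'w measure" and X Y :: "nat \<Rightarrow> 'w \<Rightarrow> real"
  assumes \<mu>: "real_distribution \<mu>" and r: "0 < r" "r < 1"
    and Q: "infinite Q" "\<And>q. q \<in> Q \<Longrightarrow> veto_trap r \<mu> q" and inp: "veto_inputs M \<mu> X Y"
  shows "infinite (veto_limit_atoms r M X Y)"
proof -
  have "inj_on (trap_law \<mu>) Q"
    using trap_law_neq[OF \<mu> r] Q(2) by (intro linorder_inj_onI') blast
  then have "infinite (trap_law \<mu> ` Q)" using Q(1) by (simp add: finite_image_iff)
  moreover have "trap_law \<mu> ` Q \<subseteq> veto_limit_atoms r M X Y"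
  proof (intro image_subsetI)
    fix q assume q: "q \<in> Q"
    note law = real_distribution_trap_law[OF \<mu> r Q(2)[OF q]]
    show "trap_law \<mu> q \<in> veto_limit_atoms r M X Y"
      using prob_trap_limit_pos[OF \<mu> r Q(2)[OF q]]
      by (simp add: veto_limit_atoms_def law veto_inputs_prob_limit[OF \<mu> law inp])
  qed
  ultimately show ?thesis using infinite_super by blast
qed

theorem proposition1p3:
  fixes r :: real
  assumes "0 < r" and "r < 1"
  shows "\<exists>\<mu> :: real measure. real_distribution \<mu> \<and> measure \<mu> {0..} = 1 \<and>
    infinite (veto_limit_atoms r (veto_space \<mu>) (\<lambda>t \<omega>. fst (\<omega> t)) (\<lambda>t \<omega>. snd (\<omega> t))) \<and>
    (\<forall>(M :: 'w measure) X Y. veto_inputs M \<mu> X Y \<longrightarrow> infinite (veto_limit_atoms r M X Y))"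
proof -
  have "0 < min r (1 - r)" "min r (1 - r) \<le> 1" using assms by auto
  then obtain p :: "nat pmf" where
    p: "\<And>k. 2 * measure_pmf.prob p {k<..} < min r (1 - r) * (pmf p k)\<^sup>2"
    using ex_pmf_light_tail by blast
  define \<mu> where "\<mu> = distr p borel real"
  have \<mu>: "real_distribution \<mu>"
    unfolding \<mu>_def by (intro prob_space.real_distribution_distr measure_pmf.prob_space_axioms) simp
  have meas: "measure \<mu> B = measure_pmf.prob p (real -` B)" if "B \<in> sets borel" for B
    unfolding \<mu>_def using that by (subst measure_distr) auto
  have trap: "veto_trap r \<mu> q" if "q \<in> range real" for q
  proof -
    from that obtain k where q: "q = real k" by blast
    have "real -` {q} = {k}" "real -` {q<..} = {k<..}" by (auto simp: q)
    then have "measure \<mu> {q} = pmf p k" "measure \<mu> {q<..} = measure_pmf.prob p {k<..}"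
      by (simp_all add: meas measure_pmf_single)
    then show ?thesis using p[of k] by (intro veto_trap_if_light_tail \<mu> assms) simp
  qed
  have inf: "infinite (range real)" by (rule range_inj_infinite) (rule inj_of_nat)
  have "real -` {0..} = UNIV" by auto
  then have "measure \<mu> {0..} = 1" by (simp add: meas)
  moreover have "infinite (veto_limit_atoms r (veto_space \<mu>) (\<lambda>t \<omega>. fst (\<omega> t)) (\<lambda>t \<omega>. snd (\<omega> t)))"
    using infinite_veto_limit_atoms[OF \<mu> assms inf trap veto_inputs_canonical[OF \<mu>]] .
  moreover have "infinite (veto_limit_atoms r M X Y)" if "veto_inputs M \<mu> X Y"
    for M :: "'w measure" and X Y
    using infinite_veto_limit_atoms[OF \<mu> assms inf trap that] .
  ultimately show ?thesis using \<mu> by blast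
qed

end
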